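(* Let $K\ge 1$, let $C_1,\dots,C_K:[0,1]^2\to[0,1]$ be bivariate copulas, and for $k\in\{1,\dots,K\}$, $j\in\{1,2\}$ let $g_j^{(k)}:[0,1]\to[0,1]$ be increasing functions with $g_j^{(k)}(0)=0$, $g_j^{(k)}(1)=1$, and such that $\prod_{k=1}^K g_j^{(k)}(u)=u$ for all $u\in[0,1]$ and $j\in\{1,2\}$. Let $\tilde C$ be the (Liebscher) copula $\tilde C(u,v)=\prod_{k=1}^K C_k(g_1^{(k)}(u),g_2^{(k)}(v))$, $(u,v)\in[0,1]^2$. (i) (Lower tail, symmetric case.) If for all $k$, $g_1^{(k)}=g_2^{(k)}$ is a regularly varying function (at the origin) with index $\gamma^{(k)}>0$, then $\lambda_L(\tilde C)=\prod_{k=1}^K\lambda_L(C_k)$. (ii) (Lower tail, asymmetric case.) If there exists $k_0\in\{1,\dots,K\}$ such that $g_1^{(k_0)}(\varepsilon)/g_2^{(k_0)}(\varepsilon)\to0$ as $\varepsilon\to0$, then $\lambda_L(\tilde C)=0$. (iii) (Upper tail, general case.) If for all $k$, $g_1^{(k)}$ and $g_2^{(k)}$ are differentiable at $1$, with derivatives at $1$ denoted by $d_1^{(k)}$ and $d_2^{(k)}$ respectively, then $\lambda_U(\tilde C)=\sum_{k=1}^K\Lambda_U(C_k;d_1^{(k)},d_2^{(k)})$ and, necessarily, $\sum_{k=1}^K d_j^{(k)}=1$ for $j\in\{1,2\}$. (iv) (Upper tail, particular case.) If, in addition to the assumptions of (iii), $d_1^{(k)}=d_2^{(k)}=:d^{(k)}$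 for all $k\in\{1,\dots,K\}$, then $\lambda_U(\tilde C)=\sum_{k=1}^K d^{(k)}\lambda_U(C_k)$ and, necessarily, $\sum_{k=1}^K d^{(k)}=1$.
   Context: For a bivariate copula $C$ and $(x,y)\in\mathbb{R}_+^2=[0,\infty)^2$, the lower and upper tail dependence functions are $$\Lambda_L(C;x,y)=\lim_{\varepsilon\to0^+}\frac{C(\varepsilon x,\varepsilon y)}{\varepsilon},\qquad \Lambda_U(C;x,y)=x+y+\lim_{\varepsilon\to0^+}\frac{C(1-\varepsilon x,1-\varepsilon y)-1}{\varepsilon}.$$ The lower and upper tail dependence coefficients are $$\lambda_L(C)=\lim_{u\to0}\frac{C(u,u)}{u},\qquad \lambda_U(C)=2-\lim_{u\to1}\frac{C(u,u)-1}{u-1},$$ so that $\lambda_L(C)=\Lambda_L(C;1,1)$ and $\lambda_U(C)=\Lambda_U(C;1,1)$. Whenever the tail dependence function or coefficient of some $C_k$ appears on the right-hand side of a formula, the corresponding tail dependence function of $C_k$ is assumed to exist on $\mathbb{R}_+^2$. A function $g:[0,1]\to[0,1]$, positive on $(0,1]$, is regularly varying at the origin with index $\gamma$ if $g(\varepsilon t)/g(\varepsilon)\to t^\gamma$ as $\varepsilon\to0^+$ for all $t>0$. Differentiability at $1$ is one-sided (from the left). "Increasing" is understood in the non-strict sense. *)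

theory Defs
  imports Complex_Main
begin

text \<open>
  Functions on the unit interval and the unit square are represented by total functions on the
  reals; only their values on \<open>{0..1}\<close> are ever constrained or, in the limits below, relevant.
\<close>

definition copula :: "(real \<Rightarrow> real \<Rightarrow> real) \<Rightarrow> bool" where
  "copula C \<longleftrightarrow>
     (\<forall>u\<in>{0..1}. \<forall>v\<in>{0..1}. C u v \<in> {0..1}) \<and>
     (\<forall>u\<in>{0..1}. C u 0 = 0 \<and> C 0 u = 0) \<and>
     (\<forall>u\<in>{0..1}. C u 1 = u \<and> C 1 u = u) \<and>
     (\<forall>u1\<in>{0..1}. \<forall>u2\<in>{0..1}. \<forall>v1\<in>{0..1}. \<forall>v2\<in>{0..1}. u1 \<le> u2 \<longrightarrow> v1 \<le> v2 \<longrightarrow>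
        C u2 v2 - C u2 v1 - C u1 v2 + C u1 v1 \<ge> 0)"

text \<open>
  The operator \<^const>\<open>Lim\<close> is total, so each limit comes with a predicate saying that it exists
  (as a real number).
\<close>

definition Lambda_L_exists :: "(real \<Rightarrow> real \<Rightarrow> real) \<Rightarrow> real \<Rightarrow> real \<Rightarrow> bool" where
  "Lambda_L_exists C x y \<longleftrightarrow>
     (\<exists>l. ((\<lambda>e. C (e * x) (e * y) / e) \<longlongrightarrow> l) (at_right 0))"

definition Lambda_L :: "(real \<Rightarrow> real \<Rightarrow> real) \<Rightarrow> real \<Rightarrow> real \<Rightarrow> real" where
  "Lambda_L C x y = Lim (at_right 0) (\<lambda>e. C (e * x) (e * y) / e)"

definition Lambda_U_exists :: "(real \<Rightarrow> real \<Rightarrow> real) \<Rightarrow> real \<Rightarrow> real \<Rightarrow> bool" where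
  "Lambda_U_exists C x y \<longleftrightarrow>
     (\<exists>l. ((\<lambda>e. (C (1 - e * x) (1 - e * y) - 1) / e) \<longlongrightarrow> l) (at_right 0))"

definition Lambda_U :: "(real \<Rightarrow> real \<Rightarrow> real) \<Rightarrow> real \<Rightarrow> real \<Rightarrow> real" where
  "Lambda_U C x y = x + y + Lim (at_right 0) (\<lambda>e. (C (1 - e * x) (1 - e * y) - 1) / e)"

definition lambda_L_exists :: "(real \<Rightarrow> real \<Rightarrow> real) \<Rightarrow> bool" where
  "lambda_L_exists C \<longleftrightarrow> (\<exists>l. ((\<lambda>u. C u u / u) \<longlongrightarrow> l) (at_right 0))"

definition lambda_L :: "(real \<Rightarrow> real \<Rightarrow> real) \<Rightarrow> real" where
  "lambda_L C = Lim (at_right 0) (\<lambda>u. C u u / u)"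

definition lambda_U_exists :: "(real \<Rightarrow> real \<Rightarrow> real) \<Rightarrow> bool" where
  "lambda_U_exists C \<longleftrightarrow> (\<exists>l. ((\<lambda>u. (C u u - 1) / (u - 1)) \<longlongrightarrow> l) (at_left 1))"

definition lambda_U :: "(real \<Rightarrow> real \<Rightarrow> real) \<Rightarrow> real" where
  "lambda_U C = 2 - Lim (at_left 1) (\<lambda>u. (C u u - 1) / (u - 1))"

definition regularly_varying_at_0 :: "(real \<Rightarrow> real) \<Rightarrow> real \<Rightarrow> bool" where
  "regularly_varying_at_0 g \<gamma> \<longleftrightarrow>
     (\<forall>u\<in>{0..1}. g u \<in> {0..1}) \<and> (\<forall>u\<in>{0<..1}. g u > 0) \<and>
     (\<forall>t>0. ((\<lambda>e. g (e * t) / g e) \<longlongrightarrow> t powr \<gamma>) (at_right 0))"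

text \<open>Here \<open>g j k\<close> is the function with lower index \<open>j\<close> and upper index \<open>k\<close>.\<close>

definition liebscher ::
  "nat \<Rightarrow> (nat \<Rightarrow> real \<Rightarrow> real \<Rightarrow> real) \<Rightarrow> (nat \<Rightarrow> nat \<Rightarrow> real \<Rightarrow> real) \<Rightarrow> real \<Rightarrow> real \<Rightarrow> real" where
  "liebscher K C g u v = (\<Prod>k=1..K. C k (g 1 k u) (g 2 k v))"

definition liebscher_family :: "nat \<Rightarrow> (nat \<Rightarrow> nat \<Rightarrow> real \<Rightarrow> real) \<Rightarrow> bool" where
  "liebscher_family K g \<longleftrightarrow>
     (\<forall>j\<in>{1,2}. \<forall>k\<in>{1..K}.
        (\<forall>u\<in>{0..1}. g j k u \<in> {0..1}) \<and> mono_on {0..1} (g j k) \<and>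
        g j k 0 = 0 \<and> g j k 1 = 1) \<and>
     (\<forall>j\<in>{1,2}. \<forall>u\<in>{0..1}. (\<Prod>k=1..K. g j k u) = u)"

lemma lambda_L_exists_iff: "lambda_L_exists C \<longleftrightarrow> Lambda_L_exists C 1 1"
  by (simp add: lambda_L_exists_def Lambda_L_exists_def)

lemma lambda_L_eq: "lambda_L C = Lambda_L C 1 1"
  by (simp add: lambda_L_def Lambda_L_def)

lemma tendsto_diagonal_at_left_1_iff:
  fixes C :: "real \<Rightarrow> real \<Rightarrow> real"
  shows "((\<lambda>u. (C u u - 1) / (u - 1)) \<longlongrightarrow> l) (at_left 1) \<longleftrightarrow>
         ((\<lambda>e. (C (1 - e * 1) (1 - e * 1) - 1) / e) \<longlongrightarrow> - l) (at_right 0)"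
proof -
  have "((\<lambda>u. (C u u - 1) / (u - 1)) \<longlongrightarrow> l) (at_left 1) \<longleftrightarrow>
        ((\<lambda>u. (C (- u) (- u) - 1) / (- u - 1)) \<longlongrightarrow> l) (at_right (- 1))"
    by (rule filterlim_at_left_to_right)
  also have "\<dots> \<longleftrightarrow> ((\<lambda>e. (C (1 - e) (1 - e) - 1) / (- e)) \<longlongrightarrow> l) (at_right 0)"
    by (subst filterlim_at_right_to_0) simp
  also have "\<dots> \<longleftrightarrow> ((\<lambda>e. (C (1 - e * 1) (1 - e * 1) - 1) / e) \<longlongrightarrow> - l) (at_right 0)"
    using tendsto_minus_cancel_left[of "\<lambda>e. (C (1 - e) (1 - e) - 1) / (- e)" "- l" "at_right 0"]
    by simp
  finally show ?thesis .
qed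

lemma lambda_U_exists_iff: "lambda_U_exists C \<longleftrightarrow> Lambda_U_exists C 1 1"
proof
  assume "lambda_U_exists C"
  then show "Lambda_U_exists C 1 1"
    unfolding lambda_U_exists_def Lambda_U_exists_def tendsto_diagonal_at_left_1_iff by blast
next
  assume "Lambda_U_exists C 1 1"
  then obtain l where "((\<lambda>e. (C (1 - e * 1) (1 - e * 1) - 1) / e) \<longlongrightarrow> - (- l)) (at_right 0)"
    unfolding Lambda_U_exists_def minus_minus by blast
  then show "lambda_U_exists C"
    unfolding lambda_U_exists_def tendsto_diagonal_at_left_1_iff by blast
qed

lemma lambda_U_eq:
  assumes "lambda_U_exists C"
  shows "lambda_U C = Lambda_U C 1 1"
proof -
  obtain l where l: "((\<lambda>u. (C u u - 1) / (u - 1)) \<longlongrightarrow> l) (at_left 1)"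
    using assms unfolding lambda_U_exists_def by blast
  have "Lim (at_left 1) (\<lambda>u. (C u u - 1) / (u - 1)) = l"
    using l by (intro tendsto_Lim) auto
  moreover have "Lim (at_right 0) (\<lambda>e. (C (1 - e * 1) (1 - e * 1) - 1) / e) = - l"
    using l unfolding tendsto_diagonal_at_left_1_iff by (intro tendsto_Lim) auto
  ultimately show ?thesis
    unfolding lambda_U_def Lambda_U_def by linarith
qed

lemma copula_mono:
  assumes C: "copula C" and "u1 \<in> {0..1}" "u2 \<in> {0..1}" "v1 \<in> {0..1}" "v2 \<in> {0..1}"
    and "u1 \<le> u2" "v1 \<le> v2"
  shows "C u1 v1 \<le> C u2 v2"
proof -
  have two: "C b d - C b c - C a d + C a c \<ge> 0"
    if "a \<in> {0..1}" "b \<in> {0..1}" "c \<in> {0..1}" "d \<in> {0..1}" "a \<le> b" "c \<le> d" for a b c d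
    using C that unfolding copula_def by blast
  have gr: "C u 0 = 0" "C 0 u = 0" if "u \<in> {0..1}" for u
    using C that unfolding copula_def by auto
  have "C u1 v1 \<le> C u2 v1"
    using two[of u1 u2 0 v1] gr assms by simp
  also have "\<dots> \<le> C u2 v2"
    using two[of 0 u2 v1 v2] gr assms by simp
  finally show ?thesis .
qed

lemma two_increasing_mult:
  fixes a b c d :: real
  assumes "0 \<le> a" "a \<le> b" "a \<le> c" "0 \<le> d - c - b + a"
    and "0 \<le> a'" "b' \<le> d'" "c' \<le> d'" "0 \<le> d' - c' - b' + a'" "0 \<le> d'"
  shows "0 \<le> d * d' - c * c' - b * b' + a * a'"
proof -
  have "d * d' - c * c' - b * b' + a * a' =
      (d - c - b + a) * d' + (b - a) * (d' - b') + (c - a) * (d' - c') + a * (d' - c' - b' + a')"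
    by (simp add: algebra_simps)
  moreover have "0 \<le> (d - c - b + a) * d'" "0 \<le> (b - a) * (d' - b')"
      "0 \<le> (c - a) * (d' - c')" "0 \<le> a * (d' - c' - b' + a')"
    using assms by (simp_all only: mult_nonneg_nonneg diff_ge_0_iff_ge)
  ultimately show ?thesis by linarith
qed

lemma copula_liebscher:
  assumes K: "1 \<le> K" and C: "\<And>k. k \<in> {1..K} \<Longrightarrow> copula (C k)" and g: "liebscher_family K g"
  shows "copula (liebscher K C g)"
proof -
  have g01: "g j k u \<in> {0..1}" if "j \<in> {1,2}" "k \<in> {1..K}" "u \<in> {0..1}" for j k u
    using g that unfolding liebscher_family_def by blast
  have gmono: "g j k u \<le> g j k v"
    if "j \<in> {1,2}" "k \<in> {1..K}" "u \<in> {0..1}" "v \<in> {0..1}" "u \<le> v" for j k u v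
    using g that unfolding liebscher_family_def mono_on_def by blast
  have gend: "g j k 0 = 0" "g j k 1 = 1" if "j \<in> {1,2}" "k \<in> {1..K}" for j k
    using g that unfolding liebscher_family_def by blast+
  have gprod: "(\<Prod>k=1..K. g j k u) = u" if "j \<in> {1,2}" "u \<in> {0..1}" for j u
    using g that unfolding liebscher_family_def by blast
  have C01: "C k u v \<in> {0..1}" if "k \<in> {1..K}" "u \<in> {0..1}" "v \<in> {0..1}" for k u v
    using C[OF that(1)] that(2,3) unfolding copula_def by blast
  have Cgr: "C k u 0 = 0" "C k 0 u = 0" if "k \<in> {1..K}" "u \<in> {0..1}" for k u
    using C[OF that(1)] that(2) unfolding copula_def by blast+
  have Cma: "C k u 1 = u" "C k 1 u = u" if "k \<in> {1..K}" "u \<in> {0..1}" for k u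
    using C[OF that(1)] that(2) unfolding copula_def by blast+
  let ?P = "\<lambda>A u v. \<Prod>k\<in>A. C k (g 1 k u) (g 2 k v)"
  have P01: "0 \<le> ?P A u v" "?P A u v \<le> 1"
    if "A \<subseteq> {1..K}" "u \<in> {0..1}" "v \<in> {0..1}" for A u v
  proof -
    have *: "C k (g 1 k u) (g 2 k v) \<in> {0..1}" if "k \<in> A" for k
      using that \<open>A \<subseteq> {1..K}\<close> \<open>u \<in> _\<close> \<open>v \<in> _\<close> by (intro C01 g01) auto
    show "0 \<le> ?P A u v" using * by (intro prod_nonneg) auto
    show "?P A u v \<le> 1" using * by (intro prod_le_1) auto
  qed
  have Cmono: "C k (g 1 k u1) (g 2 k v1) \<le> C k (g 1 k u2) (g 2 k v2)"
    if "k \<in> {1..K}" "u1 \<in> {0..1}" "u2 \<in> {0..1}" "v1 \<in> {0..1}" "v2 \<in> {0..1}"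
      "u1 \<le> u2" "v1 \<le> v2" for k u1 u2 v1 v2
    by (rule copula_mono[OF C[OF that(1)]]; (rule g01 gmono)?) (use that in auto)
  have Pmono: "?P A u1 v1 \<le> ?P A u2 v2"
    if "A \<subseteq> {1..K}" "u1 \<in> {0..1}" "u2 \<in> {0..1}" "v1 \<in> {0..1}" "v2 \<in> {0..1}"
      "u1 \<le> u2" "v1 \<le> v2" for A u1 u2 v1 v2
  proof (rule prod_mono)
    fix k assume "k \<in> A"
    then have k: "k \<in> {1..K}" using that(1) by blast
    have "C k (g 1 k u1) (g 2 k v1) \<in> {0..1}"
      using that k by (intro C01 g01) auto
    with Cmono[OF k that(2-7)]
    show "0 \<le> C k (g 1 k u1) (g 2 k v1) \<and>
        C k (g 1 k u1) (g 2 k v1) \<le> C k (g 1 k u2) (g 2 k v2)" by simp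
  qed
  have P2: "0 \<le> ?P A u2 v2 - ?P A u2 v1 - ?P A u1 v2 + ?P A u1 v1"
    if A: "A \<subseteq> {1..K}" and uv: "u1 \<in> {0..1}" "u2 \<in> {0..1}" "v1 \<in> {0..1}" "v2 \<in> {0..1}"
      "u1 \<le> u2" "v1 \<le> v2" for A u1 u2 v1 v2
  proof -
    have "finite A" using A finite_subset by blast
    then show ?thesis using A
    proof (induction A rule: finite_induct)
      case empty
      then show ?case by simp
    next
      case (insert k A)
      then have k: "k \<in> {1..K}" and A: "A \<subseteq> {1..K}" by auto
      have c2: "0 \<le> C k (g 1 k u2) (g 2 k v2) - C k (g 1 k u2) (g 2 k v1)
          - C k (g 1 k u1) (g 2 k v2) + C k (g 1 k u1) (g 2 k v1)"
      proof -
        have "g 1 k u1 \<in> {0..1}" "g 1 k u2 \<in> {0..1}" "g 2 k v1 \<in> {0..1}" "g 2 k v2 \<in> {0..1}"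
          using k uv by (auto intro!: g01 simp del: atLeastAtMost_iff)
        moreover have "g 1 k u1 \<le> g 1 k u2" "g 2 k v1 \<le> g 2 k v2"
          using k uv by (auto intro!: gmono simp del: atLeastAtMost_iff)
        ultimately show ?thesis using C[OF k] unfolding copula_def by blast
      qed
      have "0 \<le> C k (g 1 k u1) (g 2 k v1)"
        using C01[OF k g01[OF _ k] g01[OF _ k]] uv by simp
      moreover have "0 \<le> ?P A u2 v2" using P01(1)[OF A] uv by blast
      moreover have "C k (g 1 k u1) (g 2 k v1) \<le> C k (g 1 k u1) (g 2 k v2)"
          "C k (g 1 k u1) (g 2 k v1) \<le> C k (g 1 k u2) (g 2 k v1)"
        using Cmono[OF k] uv by blast+
      moreover have "?P A u1 v2 \<le> ?P A u2 v2" "?P A u2 v1 \<le> ?P A u2 v2"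
        using Pmono[OF A] uv by blast+
      moreover have "0 \<le> ?P A u1 v1" using P01(1)[OF A] uv by blast
      ultimately have "0 \<le> C k (g 1 k u2) (g 2 k v2) * ?P A u2 v2
          - C k (g 1 k u2) (g 2 k v1) * ?P A u2 v1
          - C k (g 1 k u1) (g 2 k v2) * ?P A u1 v2
          + C k (g 1 k u1) (g 2 k v1) * ?P A u1 v1"
        using c2 insert.IH[OF A] by (intro two_increasing_mult) simp_all
      then show ?case using insert.hyps by simp
    qed
  qed
  have gr: "liebscher K C g u 0 = 0" "liebscher K C g 0 u = 0" if "u \<in> {0..1}" for u
  proof -
    have k: "K \<in> {1..K}" using K by simp
    have "C K (g 1 K u) (g 2 K 0) = 0" "C K (g 1 K 0) (g 2 K u) = 0"
      using k that gend[OF _ k] Cgr[OF k] g01[OF _ k that] by auto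
    with k show "liebscher K C g u 0 = 0" "liebscher K C g 0 u = 0"
      unfolding liebscher_def by (auto intro!: prod_zero)
  qed
  have ma: "liebscher K C g u 1 = u" "liebscher K C g 1 u = u" if "u \<in> {0..1}" for u
  proof -
    have "liebscher K C g u 1 = (\<Prod>k=1..K. g 1 k u)"
      unfolding liebscher_def using gend(2) Cma(1) g01 that by (intro prod.cong) auto
    then show "liebscher K C g u 1 = u" using gprod that by simp
    have "liebscher K C g 1 u = (\<Prod>k=1..K. g 2 k u)"
      unfolding liebscher_def using gend(2) Cma(2) g01 that by (intro prod.cong) auto
    then show "liebscher K C g 1 u = u" using gprod that by simp
  qed
  have "liebscher K C g u v \<in> {0..1}" if "u \<in> {0..1}" "v \<in> {0..1}" for u v
    using P01[of "{1..K}", OF subset_refl that] by (simp add: liebscher_def)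
  moreover have "0 \<le> liebscher K C g u2 v2 - liebscher K C g u2 v1
      - liebscher K C g u1 v2 + liebscher K C g u1 v1"
    if "u1 \<in> {0..1}" "u2 \<in> {0..1}" "v1 \<in> {0..1}" "v2 \<in> {0..1}"
      "u1 \<le> u2" "v1 \<le> v2" for u1 u2 v1 v2
    using P2[of "{1..K}", OF subset_refl that] by (simp only: liebscher_def)
  ultimately show ?thesis
    unfolding copula_def using gr ma by blast
qed

end

theory Submission imports Defs
begin

text \<open>
  Everything is a statement about one-sided limits of the quotients that define the tail
  coefficients, and the marginal identity \<open>\<Prod>k g\<^sub>j\<^sup>k(u) = u\<close> lets these quotients be distributed over
  the factors of the Liebscher copula.

  For the lower tail, \<open>u\<close> in the denominator of \<open>C(u, u) / u\<close> is replaced by the product of the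
  \<open>g\<^sub>2\<^sup>k(u)\<close>, so that the quotient becomes a product of quotients
  \<open>C\<^sub>k(g\<^sub>1\<^sup>k(u), g\<^sub>2\<^sup>k(u)) / g\<^sub>2\<^sup>k(u)\<close> (lemma \<open>liebscher_diagonal_quotient\<close>). In the symmetric case a
  positive index of regular variation forces \<open>g\<^sup>k(u) \<rightarrow> 0\<close>, and each quotient is the one
  defining \<open>\<lambda>\<^sub>L(C\<^sub>k)\<close>, read along \<open>g\<^sup>k(u)\<close> instead of \<open>u\<close>. In the asymmetric case all quotients lie
  in \<open>[0, 1]\<close>, and the one with index \<open>k\<^sub>0\<close> is at most \<open>g\<^sub>1(u) / g\<^sub>2(u) \<rightarrow> 0\<close>.

  For the upper tail, the point of view is differential. The number
  \<open>\<Lambda>\<^sub>U(C; x, y)\<close> is \<open>x + y\<close> minus the left derivative at \<open>1\<close> of \<open>C\<close> along the straight path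
  \<open>u \<mapsto> (1 - (1 - u) x, 1 - (1 - u) y)\<close>, and \<open>\<lambda>\<^sub>U(C) = 2 - D\<close> with \<open>D\<close> the left derivative of the
  diagonal. Since copulas are Lipschitz continuous, the straight path may be replaced by any
  curve \<open>u \<mapsto> (g\<^sub>1(u), g\<^sub>2(u))\<close> with the same tangent at \<open>1\<close> (lemma
  \<open>copula_has_derivative_along_curve\<close>). At \<open>u = 1\<close> every factor equals \<open>1\<close>, so derivatives of
  products are sums of derivatives. Applied to \<open>\<Prod>k g\<^sub>j\<^sup>k(u) = u\<close> this gives \<open>\<Sum>k d\<^sub>j\<^sup>k = 1\<close>, and
  applied to the diagonal of the Liebscher copula it gives the formula for the upper tail
  coefficient; the constant \<open>2\<close> is absorbed by the two sums of derivatives. The last formula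
  follows because \<open>\<Lambda>\<^sub>U\<close> is homogeneous of degree one.
\<close>

section \<open>Bounds for copulas\<close>

lemma copula_range:
  assumes "copula C" "u \<in> {0..1}" "v \<in> {0..1}"
  shows "C u v \<in> {0..1}"
  using assms unfolding copula_def by blast

lemma copula_margins:
  assumes "copula C" "u \<in> {0..1}"
  shows "C u 1 = u" "C 1 u = u"
  using assms unfolding copula_def by blast+

lemma copula_le_min:
  assumes C: "copula C" and u: "u \<in> {0..1}" and v: "v \<in> {0..1}"
  shows "C u v \<le> min u v"
proof -
  have "C u v \<le> C u 1" "C u v \<le> C 1 v"
    using u v by (auto intro!: copula_mono[OF C])
  then show ?thesis
    using copula_margins[OF C] u v by simp
qed

text \<open>
  Moving the first argument from \<open>u1\<close> up to \<open>u2\<close> gains the mass of a strip; the rectangle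
  inequality on the complementary rectangle \<open>[u1, u2] \<times> [v, 1]\<close> bounds it by the mass \<open>u2 - u1\<close>
  of the full strip. The second argument is treated in the same way.
\<close>
lemma copula_lipschitz:
  assumes C: "copula C"
    and u: "u1 \<in> {0..1}" "u2 \<in> {0..1}" and v: "v1 \<in> {0..1}" "v2 \<in> {0..1}"
  shows "\<bar>C u2 v2 - C u1 v1\<bar> \<le> \<bar>u2 - u1\<bar> + \<bar>v2 - v1\<bar>"
proof -
  have rect: "C b d - C b c - C a d + C a c \<ge> 0"
    if "a \<in> {0..1}" "b \<in> {0..1}" "c \<in> {0..1}" "d \<in> {0..1}" "a \<le> b" "c \<le> d" for a b c d
    using C that unfolding copula_def by blast
  have fst_ordered: "\<bar>C b v - C a v\<bar> \<le> b - a"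
    if "a \<in> {0..1}" "b \<in> {0..1}" "a \<le> b" "v \<in> {0..1}" for a b v
    using rect[of a b v 1] copula_mono[OF C, of a b v v] copula_margins[OF C] that by force
  have snd_ordered: "\<bar>C u b - C u a\<bar> \<le> b - a"
    if "a \<in> {0..1}" "b \<in> {0..1}" "a \<le> b" "u \<in> {0..1}" for a b u
    using rect[of u 1 a b] copula_mono[OF C, of u u a b] copula_margins[OF C] that by force
  have "\<bar>C u2 v2 - C u1 v2\<bar> \<le> \<bar>u2 - u1\<bar>"
    using fst_ordered[of u1 u2 v2] fst_ordered[of u2 u1 v2] u v by linarith
  moreover have "\<bar>C u1 v2 - C u1 v1\<bar> \<le> \<bar>v2 - v1\<bar>"
    using snd_ordered[of v1 v2 u1] snd_ordered[of v2 v1 u1] u v by linarith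
  ultimately show ?thesis by linarith
qed

section \<open>Lower tail\<close>

lemma lambda_L_exists_tendsto:
  assumes "lambda_L_exists C"
  shows "((\<lambda>u. C u u / u) \<longlongrightarrow> lambda_L C) (at_right 0)"
  using assms unfolding lambda_L_exists_def lambda_L_def
  by (metis tendsto_Lim trivial_limit_at_right_real)

lemma lambda_L_eqI:
  assumes "((\<lambda>u. C u u / u) \<longlongrightarrow> l) (at_right 0)"
  shows "lambda_L_exists C \<and> lambda_L C = l"
  using assms unfolding lambda_L_exists_def lambda_L_def
  by (metis tendsto_Lim trivial_limit_at_right_real)

text \<open>
  A monotone function has a limit \<open>L \<ge> 0\<close> at the origin. If \<open>L\<close> were positive, \<open>g (e / 2) / g e\<close>
  would tend to \<open>L / L = 1\<close>, whereas regular variation prescribes the limit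
  \<open>(1 / 2) powr \<gamma> < 1\<close>.
\<close>
lemma mono_regularly_varying_tendsto_0:
  assumes mono: "mono_on {0..1} g" and rv: "regularly_varying_at_0 g \<gamma>" and "\<gamma> > 0"
  shows "(g \<longlongrightarrow> 0) (at_right 0)"
proof -
  have nonneg: "0 \<le> g u" if "u \<in> {0..1}" for u
    using rv that unfolding regularly_varying_at_0_def by auto
  define L where "L = Inf (g ` {0<..1})"
  have bdd: "bdd_below (g ` {0<..1})"
    using nonneg by (intro bdd_belowI2[of _ 0]) auto
  have L_le: "L \<le> g u" if "u \<in> {0<..1}" for u
    unfolding L_def using bdd that by (intro cInf_lower) auto
  have "(g \<longlongrightarrow> L) (at_right 0)"
  proof (rule order_tendstoI)
    fix a assume "a < L"
    show "eventually (\<lambda>u. a < g u) (at_right 0)"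
      using eventually_at_right_real[OF zero_less_one]
    proof eventually_elim
      case (elim u)
      then show ?case using L_le[of u] \<open>a < L\<close> by simp
    qed
  next
    fix a assume "L < a"
    then obtain w where w: "w \<in> {0<..1}" "g w < a"
      unfolding L_def by (subst (asm) cInf_less_iff[OF _ bdd]) auto
    have "eventually (\<lambda>u. u \<in> {0<..<w}) (at_right 0)"
      using w by (intro eventually_at_right_real) auto
    then show "eventually (\<lambda>u. g u < a) (at_right 0)"
    proof eventually_elim
      case (elim u)
      then have "g u \<le> g w"
        using w by (intro mono_onD[OF mono]) auto
      then show ?case using w by simp
    qed
  qed
  moreover have "L = 0"
  proof (rule ccontr)
    assume "L \<noteq> 0"
    have half: "filterlim (\<lambda>e::real. e * (1 / 2)) (at_right 0) (at_right 0)"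
      using filterlim_times_pos[OF filterlim_ident, of "1/2" 0 0] by (simp add: mult.commute)
    have "((\<lambda>e. g (e * (1 / 2)) / g e) \<longlongrightarrow> L / L) (at_right 0)"
      using \<open>(g \<longlongrightarrow> L) (at_right 0)\<close> \<open>L \<noteq> 0\<close>
      by (intro tendsto_divide filterlim_compose[OF _ half])
    moreover have "((\<lambda>e. g (e * (1 / 2)) / g e) \<longlongrightarrow> (1 / 2) powr \<gamma>) (at_right 0)"
      using rv unfolding regularly_varying_at_0_def by (auto dest!: spec[of _ "1/2"])
    ultimately have "(1 / 2) powr \<gamma> = L / L"
      by (intro tendsto_unique[OF trivial_limit_at_right_real])
    then have "(1 / 2) powr \<gamma> = (1 :: real)"
      using \<open>L \<noteq> 0\<close> by simp
    moreover have "(1 / 2) powr \<gamma> < (1 / 2 :: real) powr 0"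
      using \<open>\<gamma> > 0\<close> by (intro powr_less_mono') auto
    ultimately show False by simp
  qed
  ultimately show ?thesis by simp
qed

lemma liebscher_family_D:
  assumes "liebscher_family K g" "j \<in> {1,2}"
  shows "k \<in> {1..K} \<Longrightarrow> u \<in> {0..1} \<Longrightarrow> g j k u \<in> {0..1}"
    and "k \<in> {1..K} \<Longrightarrow> mono_on {0..1} (g j k)"
    and "k \<in> {1..K} \<Longrightarrow> g j k 1 = 1"
    and "u \<in> {0..1} \<Longrightarrow> (\<Prod>k=1..K. g j k u) = u"
  using assms unfolding liebscher_family_def by blast+

text \<open>
  The product of all \<open>g j i u\<close> is \<open>u > 0\<close>, so that no factor vanishes.
\<close>
lemma liebscher_family_pos:
  assumes fam: "liebscher_family K g" and j: "j \<in> {1,2}" and k: "k \<in> {1..K}"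
    and u: "u \<in> {0<..1}"
  shows "g j k u > 0"
proof -
  have "(\<Prod>k=1..K. g j k u) \<noteq> 0"
    using liebscher_family_D(4)[OF fam j, of u] u by simp
  then have "g j k u \<noteq> 0" using k by simp
  moreover have "0 \<le> g j k u"
    using liebscher_family_D(1)[OF fam j k, of u] u by simp
  ultimately show ?thesis by simp
qed

lemma liebscher_diagonal_quotient:
  assumes fam: "liebscher_family K g" and "j \<in> {1,2}" "u \<in> {0..1}"
  shows "liebscher K C g u u / u = (\<Prod>k=1..K. C k (g 1 k u) (g 2 k u) / g j k u)"
  using liebscher_family_D(4)[OF assms] by (simp add: liebscher_def prod_dividef)

lemma lambda_L_liebscher_symmetric:
  assumes fam: "liebscher_family K g"
    and eq: "\<And>k u. k \<in> {1..K} \<Longrightarrow> u \<in> {0..1} \<Longrightarrow> g 1 k u = g 2 k u"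
    and rv: "\<And>k. k \<in> {1..K} \<Longrightarrow> regularly_varying_at_0 (g 1 k) (\<gamma> k)"
    and pos: "\<And>k. k \<in> {1..K} \<Longrightarrow> \<gamma> k > 0"
    and ex: "\<And>k. k \<in> {1..K} \<Longrightarrow> lambda_L_exists (C k)"
  shows "lambda_L_exists (liebscher K C g) \<and>
    lambda_L (liebscher K C g) = (\<Prod>k=1..K. lambda_L (C k))"
proof (rule lambda_L_eqI)
  have unit: "eventually (\<lambda>u::real. u \<in> {0<..<1}) (at_right 0)"
    by (rule eventually_at_right_real) simp
  have "((\<lambda>u. C k (g 1 k u) (g 1 k u) / g 1 k u) \<longlongrightarrow> lambda_L (C k)) (at_right 0)"
    if k: "k \<in> {1..K}" for k
  proof -
    have "(g 1 k \<longlongrightarrow> 0) (at_right 0)"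
      using liebscher_family_D(2)[OF fam _ k] rv[OF k] pos[OF k]
      by (intro mono_regularly_varying_tendsto_0) auto
    moreover have "eventually (\<lambda>u. g 1 k u > 0) (at_right 0)"
      using unit by eventually_elim (auto intro!: liebscher_family_pos[OF fam _ k])
    ultimately have "filterlim (g 1 k) (at_right 0) (at_right 0)"
      by (intro tendsto_imp_filterlim_at_right)
    from filterlim_compose[OF lambda_L_exists_tendsto[OF ex[OF k]] this] show ?thesis .
  qed
  then have "((\<lambda>u. \<Prod>k=1..K. C k (g 1 k u) (g 1 k u) / g 1 k u)
      \<longlongrightarrow> (\<Prod>k=1..K. lambda_L (C k))) (at_right 0)"
    by (intro tendsto_prod)
  then show "((\<lambda>u. liebscher K C g u u / u) \<longlongrightarrow> (\<Prod>k=1..K. lambda_L (C k))) (at_right 0)"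
  proof (rule Lim_transform_eventually)
    show "eventually (\<lambda>u. (\<Prod>k=1..K. C k (g 1 k u) (g 1 k u) / g 1 k u)
        = liebscher K C g u u / u) (at_right 0)"
      using unit
    proof eventually_elim
      case (elim u)
      then have "liebscher K C g u u / u = (\<Prod>k=1..K. C k (g 1 k u) (g 2 k u) / g 1 k u)"
        by (intro liebscher_diagonal_quotient[OF fam]) auto
      also have "\<dots> = (\<Prod>k=1..K. C k (g 1 k u) (g 1 k u) / g 1 k u)"
        using elim eq by (intro prod.cong) (auto simp del: One_nat_def)
      finally show ?case by simp
    qed
  qed
qed

lemma lambda_L_liebscher_asymmetric:
  assumes C: "\<And>k. k \<in> {1..K} \<Longrightarrow> copula (C k)" and fam: "liebscher_family K g"
    and k0: "k0 \<in> {1..K}"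
    and lim: "((\<lambda>e. g 1 k0 e / g 2 k0 e) \<longlongrightarrow> 0) (at_right 0)"
  shows "lambda_L_exists (liebscher K C g) \<and> lambda_L (liebscher K C g) = 0"
proof (rule lambda_L_eqI)
  have unit: "eventually (\<lambda>u::real. u \<in> {0<..<1}) (at_right 0)"
    by (rule eventually_at_right_real) simp
  let ?q = "\<lambda>k u. C k (g 1 k u) (g 2 k u) / g 2 k u"
  have bounds: "0 \<le> ?q k u" "?q k u \<le> 1" "?q k u \<le> g 1 k u / g 2 k u"
    if k: "k \<in> {1..K}" and u: "u \<in> {0<..<1}" for k u
  proof -
    have g: "g 1 k u \<in> {0..1}" "g 2 k u \<in> {0..1}" "g 2 k u > 0"
      using k u by (intro liebscher_family_D(1)[OF fam] liebscher_family_pos[OF fam]; simp)+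
    then show "0 \<le> ?q k u" "?q k u \<le> 1" "?q k u \<le> g 1 k u / g 2 k u"
      using copula_range[OF C[OF k] g(1,2)] copula_le_min[OF C[OF k] g(1,2)]
      by (auto simp: divide_right_mono)
  qed
  have quot: "liebscher K C g u u / u = ?q k0 u * (\<Prod>k\<in>{1..K}-{k0}. ?q k u)"
    if "u \<in> {0<..<1}" for u
  proof -
    have "liebscher K C g u u / u = (\<Prod>k=1..K. ?q k u)"
      using that by (intro liebscher_diagonal_quotient[OF fam]) auto
    then show ?thesis using k0 by (simp add: prod.remove)
  qed
  show "((\<lambda>u. liebscher K C g u u / u) \<longlongrightarrow> 0) (at_right 0)"
  proof (rule tendsto_sandwich[OF _ _ tendsto_const lim])
    show "eventually (\<lambda>u. 0 \<le> liebscher K C g u u / u) (at_right 0)"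
      using unit
    proof eventually_elim
      case (elim u)
      then show ?case
        unfolding quot[OF elim] using k0 bounds(1)
        by (intro mult_nonneg_nonneg prod_nonneg) auto
    qed
    show "eventually (\<lambda>u. liebscher K C g u u / u \<le> g 1 k0 u / g 2 k0 u) (at_right 0)"
      using unit
    proof eventually_elim
      case (elim u)
      have "?q k0 u * (\<Prod>k\<in>{1..K}-{k0}. ?q k u) \<le> ?q k0 u"
        using bounds(1,2)[OF _ elim] k0 by (intro mult_right_le_one_le prod_nonneg prod_le_1) auto
      also have "\<dots> \<le> g 1 k0 u / g 2 k0 u"
        using bounds(3)[OF k0 elim] .
      finally show ?case unfolding quot[OF elim] .
    qed
  qed
qed

section \<open>Upper tail coefficients as left derivatives\<close>

lemma has_derivative_prod_at_one_values:
  fixes f :: "'i \<Rightarrow> real \<Rightarrow> real"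
  assumes der: "\<And>i. i \<in> I \<Longrightarrow> (f i has_real_derivative D i) (at x within S)"
    and one: "\<And>i. i \<in> I \<Longrightarrow> f i x = 1"
  shows "((\<lambda>u. \<Prod>i\<in>I. f i u) has_real_derivative (\<Sum>i\<in>I. D i)) (at x within S)"
proof -
  have "((\<lambda>u. \<Prod>i\<in>I. f i u) has_derivative
      (\<lambda>y. \<Sum>i\<in>I. D i * y * (\<Prod>j\<in>I - {i}. f j x))) (at x within S)"
    using der by (intro has_derivative_prod) (simp add: has_field_derivative_def)
  moreover have "(\<lambda>y. \<Sum>i\<in>I. D i * y * (\<Prod>j\<in>I - {i}. f j x)) = (*) (\<Sum>i\<in>I. D i)"
    using one by (auto simp: sum_distrib_right)
  ultimately show ?thesis by (simp add: has_field_derivative_def)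
qed

lemma Lambda_U_limit_iff_has_derivative:
  assumes "C 1 1 = 1"
  shows "((\<lambda>e. (C (1 - e * x) (1 - e * y) - 1) / e) \<longlongrightarrow> - D) (at_right 0) \<longleftrightarrow>
    ((\<lambda>u. C (1 - (1 - u) * x) (1 - (1 - u) * y)) has_real_derivative D) (at_left 1)"
  using tendsto_diagonal_at_left_1_iff[of "\<lambda>a b. C (1 - (1 - a) * x) (1 - (1 - b) * y)" D] assms
  by (simp add: has_field_derivative_iff)

lemma Lambda_U_exists_has_derivative:
  assumes one: "C 1 1 = 1" and ex: "Lambda_U_exists C x y"
  shows "((\<lambda>u. C (1 - (1 - u) * x) (1 - (1 - u) * y)) has_real_derivative
    x + y - Lambda_U C x y) (at_left 1)"
proof -
  obtain l where l: "((\<lambda>e. (C (1 - e * x) (1 - e * y) - 1) / e) \<longlongrightarrow> l) (at_right 0)"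
    using ex unfolding Lambda_U_exists_def by blast
  then have "Lambda_U C x y = x + y + l"
    unfolding Lambda_U_def using tendsto_Lim[OF trivial_limit_at_right_real l] by simp
  then show ?thesis
    using l Lambda_U_limit_iff_has_derivative[of C x y "- l", OF one] by simp
qed

lemma Lambda_U_eqI:
  assumes one: "C 1 1 = 1"
    and der: "((\<lambda>u. C (1 - (1 - u) * x) (1 - (1 - u) * y)) has_real_derivative D) (at_left 1)"
  shows "Lambda_U_exists C x y \<and> Lambda_U C x y = x + y - D"
proof -
  have l: "((\<lambda>e. (C (1 - e * x) (1 - e * y) - 1) / e) \<longlongrightarrow> - D) (at_right 0)"
    using der Lambda_U_limit_iff_has_derivative[of C x y D, OF one] by blast
  then show ?thesis
    unfolding Lambda_U_exists_def Lambda_U_def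
    using tendsto_Lim[OF trivial_limit_at_right_real l] by auto
qed

lemma lambda_U_eqI:
  assumes one: "C 1 1 = 1" and der: "((\<lambda>u. C u u) has_real_derivative D) (at_left 1)"
  shows "lambda_U_exists C \<and> lambda_U C = 2 - D"
  using Lambda_U_eqI[of C 1 1 D, OF one] der lambda_U_exists_iff[of C] lambda_U_eq[of C] by auto

text \<open>
  Scaling \<open>(x, y)\<close> by \<open>c\<close> reparametrises the straight path by \<open>u \<mapsto> 1 - (1 - u) c\<close>, so that the
  chain rule applies. The one-sided derivative is taken within \<open>{..1}\<close>, which contains the
  point itself, because for \<open>c = 0\<close> the reparametrised path stays at \<open>1\<close>.
\<close>
lemma Lambda_U_homogeneous:
  assumes one: "C 1 1 = 1" and c: "c \<ge> 0" and ex: "Lambda_U_exists C x y"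
  shows "Lambda_U C (c * x) (c * y) = c * Lambda_U C x y"
proof -
  let ?F = "\<lambda>u. C (1 - (1 - u) * x) (1 - (1 - u) * y)" and ?h = "\<lambda>u::real. 1 - (1 - u) * c"
  have closed: "at_left 1 = at (1::real) within {..1}"
  proof -
    have "{..<1} - {1} = {..1::real} - {1}" by auto
    then show ?thesis by (simp only: at_within_def)
  qed
  have "(?F has_real_derivative x + y - Lambda_U C x y) (at (?h 1) within {..1})"
    using Lambda_U_exists_has_derivative[of C, OF one ex] by (simp add: closed)
  moreover have "?h ` {..1} \<subseteq> {..1}" using c by auto
  ultimately have "(?F has_real_derivative x + y - Lambda_U C x y) (at (?h 1) within ?h ` {..1})"
    by (rule has_field_derivative_subset)
  moreover have "(?h has_real_derivative c) (at 1 within {..1})"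
    by (auto intro!: derivative_eq_intros)
  ultimately have "(?F \<circ> ?h has_real_derivative (x + y - Lambda_U C x y) * c) (at_left 1)"
    unfolding closed by (rule DERIV_image_chain)
  moreover have "?F \<circ> ?h = (\<lambda>u. C (1 - (1 - u) * (c * x)) (1 - (1 - u) * (c * y)))"
    by (simp add: fun_eq_iff mult.assoc)
  ultimately have "Lambda_U C (c * x) (c * y) = c * x + c * y - (x + y - Lambda_U C x y) * c"
    using Lambda_U_eqI[of C, OF one] by simp
  then show ?thesis by (simp add: algebra_simps)
qed

section \<open>Upper tail of a Liebscher copula\<close>

text \<open>
  Nonnegative slopes keep the tangent of \<open>u \<mapsto> (g\<^sub>1(u), g\<^sub>2(u))\<close> at \<open>u = 1\<close> inside the unit square
  for \<open>u < 1\<close> close to \<open>1\<close>, the region where the Lipschitz bound is available.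
\<close>
lemma left_derivative_at_maximum_nonneg:
  assumes der: "(g has_real_derivative d) (at_left 1)" and le: "\<And>u. u \<in> {0..1} \<Longrightarrow> g u \<le> g 1"
  shows "d \<ge> 0"
proof (rule tendsto_lowerbound)
  show "((\<lambda>u. (g u - g 1) / (u - 1)) \<longlongrightarrow> d) (at_left 1)"
    using der by (simp add: has_field_derivative_iff)
  have "eventually (\<lambda>u::real. u \<in> {0<..<1}) (at_left 1)"
    by (rule eventually_at_left_real) simp
  then show "eventually (\<lambda>u. 0 \<le> (g u - g 1) / (u - 1)) (at_left 1)"
  proof eventually_elim
    case (elim u)
    then show ?case using le[of u] by (intro divide_nonpos_nonpos) auto
  qed
qed simp

text \<open>
  By the Lipschitz bound, replacing the curve by its tangent changes the difference quotient of
  \<open>C\<close> by at most the sum of the errors of the difference quotients of \<open>g1\<close> and \<open>g2\<close>.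
\<close>
lemma copula_has_derivative_along_curve:
  assumes C: "copula C"
    and der: "(g1 has_real_derivative d1) (at_left 1)" "(g2 has_real_derivative d2) (at_left 1)"
    and one: "g1 1 = 1" "g2 1 = 1"
    and range: "\<And>u. u \<in> {0..1} \<Longrightarrow> g1 u \<in> {0..1}" "\<And>u. u \<in> {0..1} \<Longrightarrow> g2 u \<in> {0..1}"
    and ex: "Lambda_U_exists C d1 d2"
  shows "((\<lambda>u. C (g1 u) (g2 u)) has_real_derivative d1 + d2 - Lambda_U C d1 d2) (at_left 1)"
proof -
  define L :: "real \<Rightarrow> real \<Rightarrow> real" where "L d u = 1 - (1 - u) * d" for d u
  have C11: "C 1 1 = 1" using copula_margins[OF C, of 1] by simp
  have d: "d1 \<ge> 0" "d2 \<ge> 0"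
    using range one by (auto intro!: left_derivative_at_maximum_nonneg[OF der(1)]
        left_derivative_at_maximum_nonneg[OF der(2)])
  have unit: "eventually (\<lambda>u::real. u \<in> {0<..<1}) (at_left 1)"
    by (rule eventually_at_left_real) simp
  have L_range: "eventually (\<lambda>u. L d u \<in> {0..1}) (at_left 1)" if "d \<ge> 0" for d
  proof -
    have "(L d \<longlongrightarrow> 1 - (1 - 1) * d) (at_left 1)"
      unfolding L_def by (intro tendsto_intros)
    then have "eventually (\<lambda>u. L d u > 0) (at_left 1)"
      by (intro order_tendstoD) auto
    with unit show ?thesis
      by eventually_elim (use that in \<open>auto simp: L_def\<close>)
  qed
  let ?err = "\<lambda>u. \<bar>(g1 u - 1) / (u - 1) - d1\<bar> + \<bar>(g2 u - 1) / (u - 1) - d2\<bar>"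
  have "((\<lambda>u. (C (g1 u) (g2 u) - C (L d1 u) (L d2 u)) / (u - 1)) \<longlongrightarrow> 0) (at_left 1)"
  proof (rule tendsto_0_le[where f = ?err and K = 1])
    show "eventually (\<lambda>u. norm ((C (g1 u) (g2 u) - C (L d1 u) (L d2 u)) / (u - 1)) \<le>
        norm (?err u) * 1) (at_left 1)"
      using unit L_range[OF d(1)] L_range[OF d(2)]
    proof eventually_elim
      case (elim u)
      have quot: "\<bar>(w - 1) / (u - 1) - d\<bar> = \<bar>w - L d u\<bar> / \<bar>u - 1\<bar>" for w d
      proof -
        have "(w - 1) / (u - 1) - d = (w - L d u) / (u - 1)"
          using elim by (simp add: L_def field_simps)
        then show ?thesis by simp
      qed
      have "\<bar>C (g1 u) (g2 u) - C (L d1 u) (L d2 u)\<bar> \<le> \<bar>g1 u - L d1 u\<bar> + \<bar>g2 u - L d2 u\<bar>"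
        using elim range by (intro copula_lipschitz[OF C]) auto
      then have "\<bar>C (g1 u) (g2 u) - C (L d1 u) (L d2 u)\<bar> / \<bar>u - 1\<bar> \<le>
          (\<bar>g1 u - L d1 u\<bar> + \<bar>g2 u - L d2 u\<bar>) / \<bar>u - 1\<bar>"
        by (rule divide_right_mono) simp
      then show ?case by (simp add: quot add_divide_distrib)
    qed
    have "((\<lambda>u. (g1 u - 1) / (u - 1)) \<longlongrightarrow> d1) (at_left 1)"
        "((\<lambda>u. (g2 u - 1) / (u - 1)) \<longlongrightarrow> d2) (at_left 1)"
      using der one by (simp_all add: has_field_derivative_iff)
    then have "(?err \<longlongrightarrow> \<bar>d1 - d1\<bar> + \<bar>d2 - d2\<bar>) (at_left 1)"
      by (intro tendsto_add tendsto_rabs tendsto_diff tendsto_const)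
    then show "(?err \<longlongrightarrow> 0) (at_left 1)" by simp
  qed
  moreover have "((\<lambda>u. (C (L d1 u) (L d2 u) - 1) / (u - 1)) \<longlongrightarrow> d1 + d2 - Lambda_U C d1 d2)
      (at_left 1)"
    using Lambda_U_exists_has_derivative[of C, OF C11 ex] C11
    by (simp add: has_field_derivative_iff L_def)
  ultimately have "((\<lambda>u. (C (g1 u) (g2 u) - C (L d1 u) (L d2 u)) / (u - 1)
      + (C (L d1 u) (L d2 u) - 1) / (u - 1)) \<longlongrightarrow> 0 + (d1 + d2 - Lambda_U C d1 d2)) (at_left 1)"
    by (rule tendsto_add)
  then show ?thesis
    using C11 one by (simp add: has_field_derivative_iff flip: add_divide_distrib)
qed

lemma liebscher_family_derivatives_sum:
  assumes fam: "liebscher_family K g" and j: "j \<in> {1,2}"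
    and der: "\<And>k. k \<in> {1..K} \<Longrightarrow> (g j k has_real_derivative d k) (at 1 within {0..1})"
  shows "(\<Sum>k=1..K. d k) = 1"
proof -
  have "((\<lambda>u. \<Prod>k=1..K. g j k u) has_real_derivative (\<Sum>k=1..K. d k)) (at 1 within {0..1})"
    using der liebscher_family_D(3)[OF fam j] by (intro has_derivative_prod_at_one_values)
  then have "((\<lambda>u. u) has_real_derivative (\<Sum>k=1..K. d k)) (at 1 within {0..1})"
    by (rule has_field_derivative_transform_within[OF _ zero_less_one])
      (use liebscher_family_D(4)[OF fam j] in auto)
  moreover have "((\<lambda>u. u) has_real_derivative 1) (at 1 within {0..1})"
    by (rule DERIV_ident)
  moreover have "at (1::real) within {0..1} \<noteq> bot"
    by (simp add: at_within_Icc_at_left)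
  ultimately show ?thesis
    by (metis has_field_derivative_unique)
qed

lemma lambda_U_liebscher:
  assumes C: "\<And>k. k \<in> {1..K} \<Longrightarrow> copula (C k)" and fam: "liebscher_family K g"
    and der: "\<And>j k. j \<in> {1,2} \<Longrightarrow> k \<in> {1..K} \<Longrightarrow>
      (g j k has_real_derivative d j k) (at 1 within {0..1})"
    and ex: "\<And>k. k \<in> {1..K} \<Longrightarrow> Lambda_U_exists (C k) (d 1 k) (d 2 k)"
  shows "lambda_U_exists (liebscher K C g) \<and>
    lambda_U (liebscher K C g) = (\<Sum>k=1..K. Lambda_U (C k) (d 1 k) (d 2 k))"
proof -
  have one: "C k (g 1 k 1) (g 2 k 1) = 1" if k: "k \<in> {1..K}" for k
    using copula_margins[OF C[OF k], of 1] liebscher_family_D(3)[OF fam _ k] by simp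
  have left: "(g j k has_real_derivative d j k) (at_left 1)"
    if "j \<in> {1,2}" "k \<in> {1..K}" for j k
    using der[OF that] by (simp add: at_within_Icc_at_left)
  have "((\<lambda>u. C k (g 1 k u) (g 2 k u)) has_real_derivative
      d 1 k + d 2 k - Lambda_U (C k) (d 1 k) (d 2 k)) (at_left 1)" if k: "k \<in> {1..K}" for k
    using C[OF k] left[OF _ k] ex[OF k] liebscher_family_D(1,3)[OF fam _ k]
    by (intro copula_has_derivative_along_curve) blast+
  then have "((\<lambda>u. \<Prod>k=1..K. C k (g 1 k u) (g 2 k u)) has_real_derivative
      (\<Sum>k=1..K. d 1 k + d 2 k - Lambda_U (C k) (d 1 k) (d 2 k))) (at_left 1)"
    using one by (intro has_derivative_prod_at_one_values)
  moreover have "liebscher K C g 1 1 = 1"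
    using one by (simp add: liebscher_def)
  \<comment> \<open>Together these two sums cancel the constant \<open>2\<close> in the definition of \<open>\<lambda>\<^sub>U\<close>.\<close>
  moreover have "(\<Sum>k=1..K. d 1 k) = 1" "(\<Sum>k=1..K. d 2 k) = 1"
    using liebscher_family_derivatives_sum[OF fam _ der] by blast+
  ultimately show ?thesis
    using lambda_U_eqI[of "liebscher K C g"]
    by (simp add: liebscher_def sum.distrib sum_subtractf)
qed

theorem corollary1:
  fixes K :: nat
    and C :: "nat \<Rightarrow> real \<Rightarrow> real \<Rightarrow> real"
    and g :: "nat \<Rightarrow> nat \<Rightarrow> real \<Rightarrow> real"
  assumes "K \<ge> 1"
    and "\<And>k. k \<in> {1..K} \<Longrightarrow> copula (C k)"
    and "liebscher_family K g"
  shows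
    "(\<forall>\<gamma> :: nat \<Rightarrow> real.
        (\<forall>k\<in>{1..K}. (\<forall>u\<in>{0..1}. g 1 k u = g 2 k u) \<and>
            regularly_varying_at_0 (g 1 k) (\<gamma> k) \<and> \<gamma> k > 0) \<longrightarrow>
        (\<forall>k\<in>{1..K}. \<forall>x\<ge>0. \<forall>y\<ge>0. Lambda_L_exists (C k) x y) \<longrightarrow>
        lambda_L_exists (liebscher K C g) \<and>
        lambda_L (liebscher K C g) = (\<Prod>k=1..K. lambda_L (C k)))
     \<and> ((\<exists>k0\<in>{1..K}. ((\<lambda>e. g 1 k0 e / g 2 k0 e) \<longlongrightarrow> 0) (at_right 0)) \<longrightarrow>
        lambda_L_exists (liebscher K C g) \<and> lambda_L (liebscher K C g) = 0)
     \<and> (\<forall>d :: nat \<Rightarrow> nat \<Rightarrow> real.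
        (\<forall>j\<in>{1,2}. \<forall>k\<in>{1..K}. (g j k has_real_derivative d j k) (at 1 within {0..1})) \<longrightarrow>
        ((\<forall>k\<in>{1..K}. \<forall>x\<ge>0. \<forall>y\<ge>0. Lambda_U_exists (C k) x y) \<longrightarrow>
           lambda_U_exists (liebscher K C g) \<and>
           lambda_U (liebscher K C g) = (\<Sum>k=1..K. Lambda_U (C k) (d 1 k) (d 2 k))) \<and>
        (\<forall>j\<in>{1,2}. (\<Sum>k=1..K. d j k) = 1))
     \<and> (\<forall>d :: nat \<Rightarrow> real.
        (\<forall>j\<in>{1,2}. \<forall>k\<in>{1..K}. (g j k has_real_derivative d k) (at 1 within {0..1})) \<longrightarrow>
        ((\<forall>k\<in>{1..K}. \<forall>x\<ge>0. \<forall>y\<ge>0. Lambda_U_exists (C k) x y) \<longrightarrow>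
           lambda_U_exists (liebscher K C g) \<and>
           lambda_U (liebscher K C g) = (\<Sum>k=1..K. d k * lambda_U (C k))) \<and>
        (\<Sum>k=1..K. d k) = 1)"
proof (intro conjI allI impI)
  note C = assms(2) and fam = assms(3)
  have deriv_nonneg: "D \<ge> 0"
    if "(g j k has_real_derivative D) (at 1 within {0..1})" "j \<in> {1,2}" "k \<in> {1..K}" for D j k
    using that liebscher_family_D(1,3)[OF fam that(2,3)]
    by (intro left_derivative_at_maximum_nonneg[of "g j k"]) (auto simp: at_within_Icc_at_left)
  {
    fix \<gamma> :: "nat \<Rightarrow> real"
    assume "\<forall>k\<in>{1..K}. (\<forall>u\<in>{0..1}. g 1 k u = g 2 k u) \<and>
        regularly_varying_at_0 (g 1 k) (\<gamma> k) \<and> \<gamma> k > 0"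
      and "\<forall>k\<in>{1..K}. \<forall>x\<ge>0. \<forall>y\<ge>0. Lambda_L_exists (C k) x y"
    then have "lambda_L_exists (liebscher K C g) \<and>
        lambda_L (liebscher K C g) = (\<Prod>k=1..K. lambda_L (C k))"
      by (intro lambda_L_liebscher_symmetric[OF fam, of \<gamma>]) (auto simp: lambda_L_exists_iff)
    then show "lambda_L_exists (liebscher K C g)"
      and "lambda_L (liebscher K C g) = (\<Prod>k=1..K. lambda_L (C k))" by blast+
  }
  {
    assume "\<exists>k0\<in>{1..K}. ((\<lambda>e. g 1 k0 e / g 2 k0 e) \<longlongrightarrow> 0) (at_right 0)"
    then have "lambda_L_exists (liebscher K C g) \<and> lambda_L (liebscher K C g) = 0"
      using lambda_L_liebscher_asymmetric[of K C, OF C fam] by blast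
    then show "lambda_L_exists (liebscher K C g)" and "lambda_L (liebscher K C g) = 0" by blast+
  }
  {
    fix d :: "nat \<Rightarrow> nat \<Rightarrow> real"
    assume der: "\<forall>j\<in>{1,2}. \<forall>k\<in>{1..K}. (g j k has_real_derivative d j k) (at 1 within {0..1})"
    show "\<forall>j\<in>{1,2}. (\<Sum>k=1..K. d j k) = 1"
      using der by (intro ballI liebscher_family_derivatives_sum[OF fam]) blast+
    assume ex: "\<forall>k\<in>{1..K}. \<forall>x\<ge>0. \<forall>y\<ge>0. Lambda_U_exists (C k) x y"
    have "Lambda_U_exists (C k) (d 1 k) (d 2 k)" if "k \<in> {1..K}" for k
      using ex der deriv_nonneg that by blast
    then have "lambda_U_exists (liebscher K C g) \<and>
        lambda_U (liebscher K C g) = (\<Sum>k=1..K. Lambda_U (C k) (d 1 k) (d 2 k))"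
      using der by (intro lambda_U_liebscher[of K C, OF C fam]) blast+
    then show "lambda_U_exists (liebscher K C g)"
      and "lambda_U (liebscher K C g) = (\<Sum>k=1..K. Lambda_U (C k) (d 1 k) (d 2 k))" by blast+
  }
  {
    fix d :: "nat \<Rightarrow> real"
    assume der: "\<forall>j\<in>{1,2}. \<forall>k\<in>{1..K}. (g j k has_real_derivative d k) (at 1 within {0..1})"
    show "(\<Sum>k=1..K. d k) = 1"
      using der by (intro liebscher_family_derivatives_sum[OF fam, of 1]) blast+
    assume ex: "\<forall>k\<in>{1..K}. \<forall>x\<ge>0. \<forall>y\<ge>0. Lambda_U_exists (C k) x y"
    have d: "d k \<ge> 0" if "k \<in> {1..K}" for k
      using der deriv_nonneg[of 1 k "d k"] that by blast
    have "lambda_U_exists (liebscher K C g) \<and>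
        lambda_U (liebscher K C g) = (\<Sum>k=1..K. Lambda_U (C k) (d k) (d k))"
      using der ex d by (intro lambda_U_liebscher[of K C g "\<lambda>_. d", OF C fam]) blast+
    moreover have "Lambda_U (C k) (d k) (d k) = d k * lambda_U (C k)" if k: "k \<in> {1..K}" for k
    proof -
      have ex11: "Lambda_U_exists (C k) 1 1"
        using ex k by (meson zero_le_one)
      then have "lambda_U (C k) = Lambda_U (C k) 1 1"
        by (intro lambda_U_eq) (simp add: lambda_U_exists_iff)
      then show ?thesis
        using Lambda_U_homogeneous[of "C k", OF _ d[OF k] ex11] copula_margins(1)[OF C[OF k], of 1] by simp
    qed
    ultimately show "lambda_U_exists (liebscher K C g)"
      and "lambda_U (liebscher K C g) = (\<Sum>k=1..K. d k * lambda_U (C k))" by simp_all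
  }
qed

end
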